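(* For all integers $m,n\geq 1$ the entries of the zpread matrix $Z=(Z_{mn})_{m,n\geq 1}$ are $$Z_{mn}=(-1)^{m+1}\,p^{[2m]}_{n-m}.$$
   Context: The spread polynomials are defined by $S_0(x)=0$, $S_1(x)=x$, $S_n(x)=2(1-2x)S_{n-1}(x)-S_{n-2}(x)+2x$ for $n\geq 2$. The zpread polynomials are $Z_n(x):=4S_n(x/4)$. The zpread matrix $Z=(Z_{mn})_{m,n\geq 1}$ is defined by $Z_n(x)=\sum_{m\geq 1}Z_{mn}x^m$ for $n\geq 1$. For an integer $i\geq 1$ the $i$-dimensional pyramidal numbers $(p^{[i]}_j)_{j\geq 0}$ are defined by $\sum_{j\geq 0}p^{[i]}_jt^j=\frac{1+t}{(1-t)^{i+1}}$, and by convention $p^{[i]}_j=0$ for $j<0$. *)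

theory Defs
  imports "HOL-Computational_Algebra.Computational_Algebra"
begin

fun spread :: "nat \<Rightarrow> rat poly" where
  "spread 0 = 0"
| "spread (Suc 0) = [:0, 1:]"
| "spread (Suc (Suc n)) =
     2 * (1 - 2 * [:0, 1:]) * spread (Suc n) - spread n + 2 * [:0, 1:]"

definition zpread :: "nat \<Rightarrow> rat poly" where
  "zpread n = smult 4 (pcompose (spread n) [:0, 1/4:])"

text \<open>The first index \<open>m\<close> is the row (the exponent of \<open>x\<close>), the second index \<open>n\<close> is the column
  (the index of the polynomial). Only \<open>m \<ge> 1\<close> and \<open>n \<ge> 1\<close> are relevant; the lemma
  \<open>zpread_expansion\<close> below confirms that \<open>zpread n\<close> has no constant term, so that these
  coefficients are the ones in the expansion of \<open>zpread n\<close> in positive powers of \<open>x\<close>.\<close>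

definition zpread_matrix :: "nat \<Rightarrow> nat \<Rightarrow> rat" where
  "zpread_matrix m n = coeff (zpread n) m"

definition pyramidal :: "nat \<Rightarrow> int \<Rightarrow> rat" where
  "pyramidal i j =
     (if j < 0 then 0
      else fps_nth ((1 + fps_X) / (1 - fps_X) ^ (i + 1)) (nat j))"

lemma coeff_spread_0: "coeff (spread n) 0 = 0"
  by (induction n rule: spread.induct) (simp_all add: coeff_mult)

lemma degree_spread_le: "degree (spread n) \<le> n"
proof (induction n rule: spread.induct)
  case (3 n)
  have *: "(2 * (1 - 2 * [:0, 1:]) :: rat poly) = [:2, -4:]"
    by (simp add: numeral_poly one_pCons)
  have "degree ([:2, -4:] * spread (Suc n)) \<le> Suc (Suc n)"
    using degree_mult_le[of "[:2, -4:]" "spread (Suc n)"] 3 by simp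
  moreover have "degree (2 * [:0, 1:] :: rat poly) \<le> Suc (Suc n)"
    by (simp add: numeral_poly)
  ultimately show ?case
    using 3 unfolding spread.simps * by (intro degree_add_le degree_diff_le) auto
qed simp_all

lemma zpread_expansion: "zpread n = (\<Sum>m = 1..n. monom (zpread_matrix m n) m)"
proof -
  have deg: "degree (zpread n) \<le> n"
    unfolding zpread_def
    using degree_spread_le[of n] by (simp add: degree_pcompose)
  have "coeff (zpread n) 0 = 0"
    by (simp add: zpread_def coeff_pcompose_0 coeff_spread_0 poly_0_coeff_0)
  then have "coeff (zpread n) k = 0" if "k \<notin> {1..n}" for k
    using that deg by (cases "k = 0") (auto intro: coeff_eq_0)
  then show ?thesis
    by (intro poly_eqI) (auto simp: coeff_sum zpread_matrix_def)
qed

end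

theory Submission
  imports Defs
begin

text \<open>The recurrence of the spread polynomials becomes
  \<open>Z\<^sub>n\<^sub>+\<^sub>2 = (2 - x) Z\<^sub>n\<^sub>+\<^sub>1 - Z\<^sub>n + 2x\<close> after rescaling. For the generating function
  \<open>F\<^sub>m(t) = \<Sum>\<^sub>n Z\<^sub>m\<^sub>n t\<^sup>n\<close> of the \<open>m\<close>-th row of the zpread matrix, it says that
  \<open>(1 - t)\<^sup>2 F\<^sub>m = -t F\<^sub>m\<^sub>-\<^sub>1\<close> for \<open>m > 1\<close>, while the inhomogeneous term \<open>2x\<close> together with
  \<open>Z\<^sub>1 = x\<close> gives \<open>(1 - t)\<^sup>2 F\<^sub>1 = t (1 + t) / (1 - t)\<close>
  (\<open>zpread_row_fps_Suc\<close> covers both cases). Hence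
  \<open>F\<^sub>m = (-1)\<^sup>m\<^sup>+\<^sup>1 t\<^sup>m (1 + t) / (1 - t)\<^sup>2\<^sup>m\<^sup>+\<^sup>1\<close> (\<open>zpread_row_fps_eq\<close>), which is, up to sign, the
  generating function of the \<open>2m\<close>-dimensional pyramidal numbers shifted by \<open>m\<close>.\<close>

lemma zpread_0: "zpread 0 = 0"
  by (simp add: zpread_def)

lemma zpread_1: "zpread (Suc 0) = [:0, 1:]"
  by (simp add: zpread_def pcompose_pCons)

lemma zpread_Suc_Suc:
  "zpread (Suc (Suc n)) = smult 2 (zpread (Suc n)) - pCons 0 (zpread (Suc n)) - zpread n + [:0, 2:]"
proof -
  have "2 * (1 - 2 * [:0, 1:]) = ([:2, -4:] :: rat poly)" "2 * [:0, 1:] = ([:0, 2:] :: rat poly)"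
    by (simp_all add: numeral_poly one_pCons)
  then have "spread (Suc (Suc n)) = [:2, -4:] * spread (Suc n) - spread n + [:0, 2:]"
    by (simp only: spread.simps)
  also have "pcompose \<dots> [:0, 1/4:] =
      [:2, -1:] * pcompose (spread (Suc n)) [:0, 1/4:] - pcompose (spread n) [:0, 1/4:] + [:0, 1/2:]"
    by (simp only: pcompose_add pcompose_diff pcompose_mult) (simp add: pcompose_pCons)
  finally show ?thesis
    by (simp add: zpread_def smult_add_right smult_diff_right)
qed

lemma zpread_matrix_0_left: "zpread_matrix 0 n = 0"
  by (simp add: zpread_matrix_def zpread_def coeff_pcompose_0 coeff_spread_0 poly_0_coeff_0)

lemma zpread_matrix_0_right: "zpread_matrix m 0 = 0"
  by (simp add: zpread_matrix_def zpread_0)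

lemma zpread_matrix_Suc_1: "zpread_matrix (Suc m) (Suc 0) = of_bool (m = 0)"
  by (cases m) (simp_all add: zpread_matrix_def zpread_1)

lemma zpread_matrix_Suc_Suc_Suc:
  "zpread_matrix (Suc m) (Suc (Suc n)) =
     2 * zpread_matrix (Suc m) (Suc n) - zpread_matrix m (Suc n) - zpread_matrix (Suc m) n
     + 2 * of_bool (m = 0)"
  by (cases m) (simp_all add: zpread_matrix_def zpread_Suc_Suc)

text \<open>The generating function of row \<open>m\<close>. The summation starts at column \<open>0\<close>, which contributes
  nothing because \<open>Z\<^sub>0 = 0\<close>.\<close>

definition zpread_row_fps :: "nat \<Rightarrow> rat fps" where
  "zpread_row_fps m = Abs_fps (zpread_matrix m)"

lemma zpread_row_fps_Suc:
  "(1 - fps_X) ^ 2 * zpread_row_fps (Suc m) =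
     - fps_X * zpread_row_fps m + of_bool (m = 0) * (fps_X * (1 + fps_X) / (1 - fps_X))"
proof -
  \<comment> \<open>the power series expansion of \<open>t (1 + t) / (1 - t)\<close>, whose coefficients are visible\<close>
  define G :: "rat fps" where "G = Abs_fps (\<lambda>n. if n = 0 then 0 else if n = 1 then 1 else 2)"
  have "(1 - fps_X) * G = fps_X * (1 + fps_X)"
  proof (rule fps_ext)
    fix n
    consider "n = 0" | "n = 1" | "n = 2" | k where "n = Suc (Suc (Suc k))"
      by (metis One_nat_def Suc_1 not0_implies_Suc)
    then show "fps_nth ((1 - fps_X) * G) n = fps_nth (fps_X * (1 + fps_X)) n"
      by cases (simp_all add: G_def algebra_simps)
  qed
  then have G: "fps_X * (1 + fps_X) / (1 - fps_X) = G"
    by (metis fps_nth_Abs_fps nonzero_mult_div_cancel_left fps_one_nth fps_sub_nth fps_X_nth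
        fps_zero_nth zero_neq_one diff_zero)
  have "(1 - fps_X) ^ 2 * zpread_row_fps (Suc m) = - fps_X * zpread_row_fps m + of_bool (m = 0) * G"
  proof (rule fps_ext)
    fix n
    have sq: "(1 - fps_X) ^ 2 * zpread_row_fps (Suc m) = zpread_row_fps (Suc m)
        - fps_const 2 * (fps_X * zpread_row_fps (Suc m)) + fps_X * (fps_X * zpread_row_fps (Suc m))"
      by (simp add: power2_eq_square algebra_simps flip: numeral_fps_const)
    consider "n = 0" | "n = 1" | k where "n = Suc (Suc k)"
      by (metis One_nat_def not0_implies_Suc)
    then show "fps_nth ((1 - fps_X) ^ 2 * zpread_row_fps (Suc m)) n =
        fps_nth (- fps_X * zpread_row_fps m + of_bool (m = 0) * G) n"
      unfolding sq
      by cases (simp_all add: zpread_row_fps_def G_def zpread_matrix_0_right zpread_matrix_Suc_1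
          zpread_matrix_Suc_Suc_Suc)
  qed
  then show ?thesis
    by (simp add: G)
qed

lemma zpread_row_fps_0: "zpread_row_fps 0 = 0"
  by (rule fps_ext) (simp add: zpread_row_fps_def zpread_matrix_0_left)

lemma zpread_row_fps_eq:
  "zpread_row_fps (Suc m) =
     (-1) ^ m * fps_X ^ Suc m * ((1 + fps_X) / (1 - fps_X) ^ (2 * Suc m + 1))"
proof -
  have unit: "is_unit ((1 - fps_X :: rat fps) ^ k)" for k
    by (simp add: fps_is_unit_iff)
  have "(1 - fps_X) ^ (2 * Suc m + 1) * zpread_row_fps (Suc m) = (-1) ^ m * fps_X ^ Suc m * (1 + fps_X)"
  proof (induction m)
    case 0
    have "(1 - fps_X) * (fps_X * (1 + fps_X) / (1 - fps_X)) = (fps_X * (1 + fps_X) :: rat fps)"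
      using unit[of 1] by (simp add: unit_imp_dvd)
    then show ?case
      using zpread_row_fps_Suc[of 0]
      by (simp add: zpread_row_fps_0 power3_eq_cube power2_eq_square mult.assoc eval_nat_numeral)
  next
    case (Suc m)
    have "(1 - fps_X) ^ (2 * Suc (Suc m) + 1) * zpread_row_fps (Suc (Suc m))
        = (1 - fps_X) ^ (2 * Suc m + 1) * ((1 - fps_X) ^ 2 * zpread_row_fps (Suc (Suc m)))"
      by (simp add: power2_eq_square mult_ac)
    also have "\<dots> = - fps_X * ((1 - fps_X) ^ (2 * Suc m + 1) * zpread_row_fps (Suc m))"
      by (subst zpread_row_fps_Suc) (simp add: mult_ac)
    also have "\<dots> = (-1) ^ Suc m * fps_X ^ Suc (Suc m) * (1 + fps_X)"
      by (subst Suc.IH) (simp add: mult_ac)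
    finally show ?case .
  qed
  then have "zpread_row_fps (Suc m) =
      ((-1) ^ m * fps_X ^ Suc m * (1 + fps_X)) div (1 - fps_X) ^ (2 * Suc m + 1)"
    using unit[of "2 * Suc m + 1"] by (metis nonzero_mult_div_cancel_left not_is_unit_0)
  also have "\<dots> = (-1) ^ m * fps_X ^ Suc m * ((1 + fps_X) / (1 - fps_X) ^ (2 * Suc m + 1))"
    using unit[of "2 * Suc m + 1"] by (metis div_mult_swap unit_imp_dvd)
  finally show ?thesis .
qed

theorem theorem11p5:
  fixes m n :: nat
  assumes "m \<ge> 1" and "n \<ge> 1"
  shows "zpread_matrix m n = (-1) ^ (m + 1) * pyramidal (2 * m) (int n - int m)"
proof -
  obtain k where m: "m = Suc k"
    using assms(1) by (cases m) auto
  define P :: "rat fps" where "P = (1 + fps_X) / (1 - fps_X) ^ (2 * m + 1)"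
  have sign: "(-1) ^ k = (fps_const ((-1) ^ k) :: rat fps)"
    by (simp flip: fps_const_power fps_const_neg)
  have "zpread_matrix m n = fps_nth (zpread_row_fps m) n"
    by (simp add: zpread_row_fps_def)
  also have "zpread_row_fps m = fps_const ((-1) ^ k) * (fps_X ^ m * P)"
    unfolding m P_def zpread_row_fps_eq sign by (simp only: mult.assoc)
  also have "fps_nth \<dots> n = (-1) ^ k * (if n < m then 0 else fps_nth P (n - m))"
    by (simp only: fps_mult_left_const_nth fps_X_power_mult_nth)
  also have "(if n < m then 0 else fps_nth P (n - m)) = pyramidal (2 * m) (int n - int m)"
    by (simp add: pyramidal_def P_def nat_diff_distrib)
  finally show ?thesis
    by (simp add: m)
qed

end
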